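(* Let $S_1, Y, S_2, Z$ be real-valued random variables on a common probability space, all having finite moments of every order, such that the random vectors $(S_1,Y)$ and $(S_2,Z)$ are independent and $S_1$, $S_2$ are nondegenerate. Suppose that the law of $aS_1+Y+bS_2+Z$, for $a,b\in\mathbb{R}$, depends on $(a,b)$ only through $a^2+b^2$. Then $S_1$ and $S_2$ have the same normal distribution, and $\operatorname{cov}(S_1,Y)=\operatorname{cov}(S_2,Z)=0$.
   Context: A random variable is nondegenerate if it is not almost surely constant. "The law of $aS_1+Y+bS_2+Z$ depends on $(a,b)$ only through $a^2+b^2$" means: whenever $a,b,a',b'\in\mathbb{R}$ satisfy $a^2+b^2=a'^2+b'^2$, the random variables $aS_1+Y+bS_2+Z$ and $a'S_1+Y+b'S_2+Z$ have the same distribution. Independence of $(S_1,Y)$ and $(S_2,Z)$ is independence of the two vectors; nothing is assumed about dependence inside each vector. *)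

theory Defs
  imports "HOL-Probability.Probability"
begin

definition nondegenerate :: "'a measure \<Rightarrow> ('a \<Rightarrow> real) \<Rightarrow> bool" where
  "nondegenerate M X \<longleftrightarrow> \<not> (\<exists>c. AE \<omega> in M. X \<omega> = c)"

definition finite_moments :: "'a measure \<Rightarrow> ('a \<Rightarrow> real) \<Rightarrow> bool" where
  "finite_moments M X \<longleftrightarrow> (\<forall>n::nat. integrable M (\<lambda>\<omega>. \<bar>X \<omega>\<bar> ^ n))"

definition covariance :: "'a measure \<Rightarrow> ('a \<Rightarrow> real) \<Rightarrow> ('a \<Rightarrow> real) \<Rightarrow> real" where
  "covariance M X Y =
     integral\<^sup>L M (\<lambda>\<omega>. (X \<omega> - integral\<^sup>L M X) * (Y \<omega> - integral\<^sup>L M Y))"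

end

theory Submission
  imports Defs "HOL-Real_Asymp.Real_Asymp"
begin

text \<open>Dividing a S1 + Y + b S2 + Z by a scale that tends to infinity removes Y + Z, so the
  independent pair (S1, S2) has a rotation invariant law. Hence both variables have the same
  characteristic function \<phi>, which is even and satisfies \<phi>(u) \<phi>(v) = \<phi>(sqrt (u^2 + v^2)); thus
  \<phi>(u) = \<phi>(u / sqrt n)^n, which tends to a centred Gaussian characteristic function as in the
  central limit theorem. The covariances vanish on comparing the second moments for a and -a
  (with b = 0), and symmetrically for b.\<close>

section \<open>Characteristic functions: Gaussian limit, symmetry and rotation invariance\<close>

lemma (in prob_space) char_distr:
  fixes X :: "'a \<Rightarrow> real"
  assumes [measurable]: "X \<in> borel_measurable M"
  shows "char (distr M borel X) t = (CLINT \<omega>|M. iexp (t * X \<omega>))"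
  by (simp add: char_def integral_distr)

lemma (in prob_space) char_distr_cmult:
  fixes X :: "'a \<Rightarrow> real"
  assumes [measurable]: "X \<in> borel_measurable M"
  shows "char (distr M borel (\<lambda>\<omega>. c * X \<omega>)) t = char (distr M borel X) (c * t)"
  by (simp add: char_distr mult_ac)

text \<open>Rescaling to X / \<sigma> turns the given characteristic function into that of the
  standard normal law, so Levy's uniqueness theorem applies; the scale is then put back.\<close>

lemma (in prob_space) distributed_normal_density_if_char:
  fixes X :: "'a \<Rightarrow> real"
  assumes [measurable]: "X \<in> borel_measurable M" and \<sigma>: "\<sigma> > 0"
    and char: "\<And>t. char (distr M borel X) t = complex_of_real (exp (- (\<sigma>\<^sup>2 * t\<^sup>2 / 2)))"
  shows "distributed M lborel X (normal_density 0 \<sigma>)"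
proof -
  let ?X = "\<lambda>\<omega>. X \<omega> / \<sigma>"
  have "char (distr M borel ?X) t = char std_normal_distribution t" for t
    using char_distr_cmult[of X "1 / \<sigma>" t] \<sigma>
    by (simp add: char char_std_normal_distribution power_divide)
  then have "distr M borel ?X = std_normal_distribution"
    by (intro Levy_uniqueness real_distribution_distr real_dist_normal_dist) auto
  then have "distr M lborel ?X = std_normal_distribution"
    by (simp cong: distr_cong)
  then have "distributed M lborel (\<lambda>\<omega>. (X \<omega> - 0) / \<sigma>) std_normal_density"
    by (simp add: distributed_def)
  then show ?thesis
    using normal_standard_normal_convert[OF \<sigma>, of X 0] by simp
qed

text \<open>This is the central limit argument with \<open>stable\<close> in place of a sum of
  independent copies: the n-th power of the characteristic function at t / sqrt n does not depend on
  n, while second-order Taylor expansion compares it with (1 - v t^2 / (2n))^n. The third moment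
  makes the error explicit.\<close>

lemma (in prob_space) char_eq_exp_if_stable:
  fixes X :: "'a \<Rightarrow> real"
  assumes [measurable]: "X \<in> borel_measurable M"
    and int: "integrable M X" "integrable M (\<lambda>\<omega>. (X \<omega>)\<^sup>2)" "integrable M (\<lambda>\<omega>. \<bar>X \<omega>\<bar> ^ 3)"
    and mean: "expectation X = 0" and var: "expectation (\<lambda>\<omega>. (X \<omega>)\<^sup>2) = v"
    and stable: "\<And>t n. n > 0 \<Longrightarrow>
      char (distr M borel X) t = char (distr M borel X) (t / sqrt (real n)) ^ n"
  shows "char (distr M borel X) t = complex_of_real (exp (- (v * t\<^sup>2 / 2)))"
proof (rule LIMSEQ_unique)
  let ?\<phi> = "char (distr M borel X)"
  let ?g = "\<lambda>n::nat. 1 + (- (v * t\<^sup>2 / 2)) / real n"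
  interpret D: real_distribution "distr M borel X"
    by (rule real_distribution_distr) simp
  \<comment> \<open>At t / sqrt n the third-order Taylor remainder is at most C / (n sqrt n).
    Passing to n-th powers costs a factor n and leaves C / sqrt n.\<close>
  define C where "C = \<bar>t\<bar> ^ 3 / 6 * expectation (\<lambda>\<omega>. \<bar>X \<omega>\<bar> ^ 3)"
  have v: "v \<ge> 0"
    unfolding var[symmetric] by simp
  \<comment> \<open>The condition n >= v t^2 keeps \<open>?g n\<close> between 1/2 and 1: the
    estimate |z^n - w^n| <= n |z - w| is applied with both bases in the closed unit disc.\<close>
  have bound: "norm (?\<phi> t - complex_of_real (?g n ^ n)) \<le> C / sqrt (real n)"
    if n: "real n \<ge> v * t\<^sup>2" "n > 0" for n
  proof -
    let ?t = "t / sqrt (real n)"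
    have t2: "?t\<^sup>2 = t\<^sup>2 / real n"
      using n by (simp add: power_divide)
    have g: "complex_of_real (?g n) = 1 - ?t\<^sup>2 * v / 2"
      unfolding t2 by (simp add: field_simps)
    have "norm (?\<phi> ?t - complex_of_real (?g n)) \<le>
        ?t\<^sup>2 / 6 * expectation (\<lambda>\<omega>. min (6 * (X \<omega>)\<^sup>2) (\<bar>?t\<bar> * \<bar>X \<omega>\<bar> ^ 3))"
      unfolding g using int mean var by (intro char_approx3'[where X=X]) auto
    also have "\<dots> \<le> ?t\<^sup>2 / 6 * expectation (\<lambda>\<omega>. \<bar>?t\<bar> * \<bar>X \<omega>\<bar> ^ 3)"
      using int by (intro mult_left_mono integral_mono) auto
    also have "\<dots> = ?t\<^sup>2 * \<bar>?t\<bar> / 6 * expectation (\<lambda>\<omega>. \<bar>X \<omega>\<bar> ^ 3)"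
      by simp
    also have "?t\<^sup>2 * \<bar>?t\<bar> = \<bar>t\<bar> ^ 3 / (real n * sqrt (real n))"
      unfolding t2 by (simp add: abs_divide power3_eq_cube power2_eq_square flip: abs_mult)
    finally have *: "norm (?\<phi> ?t - complex_of_real (?g n)) \<le> C / (real n * sqrt (real n))"
      by (simp add: C_def)
    have "\<bar>?g n\<bar> \<le> 1"
      using n v by (intro abs_leI) (auto simp: field_simps)
    then have "norm (?\<phi> ?t ^ n - complex_of_real (?g n) ^ n) \<le>
        real n * norm (?\<phi> ?t - complex_of_real (?g n))"
      by (intro norm_power_diff D.cmod_char_le_1) (simp only: norm_of_real)
    also have "\<dots> \<le> real n * (C / (real n * sqrt (real n)))"
      by (intro mult_left_mono *) simp
    also have "\<dots> = C / sqrt (real n)"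
      using n by simp
    finally show ?thesis
      using stable[OF n(2), of t] by (simp only: of_real_power)
  qed
  have "eventually (\<lambda>n. real n \<ge> v * t\<^sup>2 \<and> n > 0) sequentially"
    by (intro eventually_conj eventually_gt_at_top) real_asymp
  then have "eventually (\<lambda>n. norm (?\<phi> t - complex_of_real (?g n ^ n)) \<le> C / sqrt (real n)) sequentially"
    by eventually_elim (use bound in blast)
  moreover have "(\<lambda>n. C / sqrt (real n)) \<longlonglongrightarrow> 0"
    by real_asymp
  ultimately have "(\<lambda>n. ?\<phi> t - complex_of_real (?g n ^ n)) \<longlonglongrightarrow> 0"
    by (rule Lim_null_comparison)
  from tendsto_diff[OF tendsto_const[of "?\<phi> t"] this]
  show "(\<lambda>n. complex_of_real (?g n ^ n)) \<longlonglongrightarrow> ?\<phi> t"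
    by simp
  show "(\<lambda>n. complex_of_real (?g n ^ n)) \<longlonglongrightarrow> complex_of_real (exp (- (v * t\<^sup>2 / 2)))"
    by (intro tendsto_of_real tendsto_exp_limit_sequentially)
qed

text \<open>By uniqueness X and -X have the same law, so the mean equals its own negative. For a
  non-integrable X the integral is 0 by its default value.\<close>

lemma (in prob_space) expectation_eq_0_if_symmetric:
  fixes X :: "'a \<Rightarrow> real"
  assumes [measurable]: "X \<in> borel_measurable M"
    and sym: "\<And>t. char (distr M borel X) (- t) = char (distr M borel X) t"
  shows "expectation X = 0"
proof -
  have "char (distr M borel (\<lambda>\<omega>. - X \<omega>)) t = char (distr M borel X) t" for t
    using char_distr_cmult[of X "-1" t] sym by simp
  then have "distr M borel (\<lambda>\<omega>. - X \<omega>) = distr M borel X"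
    by (intro Levy_uniqueness real_distribution_distr) auto
  then have "integral\<^sup>L (distr M borel (\<lambda>\<omega>. - X \<omega>)) (\<lambda>x. x) = integral\<^sup>L (distr M borel X) (\<lambda>x. x)"
    by simp
  then show ?thesis
    by (simp add: integral_distr)
qed

text \<open>Three choices of points on a common circle suffice: (0, t) and (t, 0) identify the two
  functions, (t, 0) and (-t, 0) give evenness, and (u, v) with (sqrt (u^2 + v^2), 0) gives the
  functional equation that is iterated to reach the n-th power.\<close>

lemma (in prob_space) rotation_invariant_chars:
  fixes X Y :: "'a \<Rightarrow> real"
  assumes [measurable]: "X \<in> borel_measurable M" "Y \<in> borel_measurable M"
    and rot: "\<And>a b a' b'. a\<^sup>2 + b\<^sup>2 = a'\<^sup>2 + b'\<^sup>2 \<Longrightarrow>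
      char (distr M borel X) a * char (distr M borel Y) b =
      char (distr M borel X) a' * char (distr M borel Y) b'"
  shows "char (distr M borel Y) t = char (distr M borel X) t"
    and "char (distr M borel X) (- t) = char (distr M borel X) t"
    and "n > 0 \<Longrightarrow> char (distr M borel X) t = char (distr M borel X) (t / sqrt (real n)) ^ n"
proof -
  let ?\<phi> = "char (distr M borel X)" and ?\<psi> = "char (distr M borel Y)"
  interpret X: real_distribution "distr M borel X"
    by (rule real_distribution_distr) simp
  interpret Y: real_distribution "distr M borel Y"
    by (rule real_distribution_distr) simp
  have eq: "?\<psi> t = ?\<phi> t" for t
    using rot[of 0 t t 0] by (simp add: X.char_zero Y.char_zero)
  then show "?\<psi> t = ?\<phi> t" .
  show even: "?\<phi> (- t) = ?\<phi> t" for t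
    using rot[of t 0 "- t" 0] by (simp add: Y.char_zero)
  have mult: "?\<phi> (sqrt (u\<^sup>2 + v\<^sup>2)) = ?\<phi> u * ?\<phi> v" for u v
    using rot[of u v "sqrt (u\<^sup>2 + v\<^sup>2)" 0] by (simp add: eq X.char_zero)
  \<comment> \<open>In the induction, sqrt (n + 1) |s| is the hypotenuse over the legs sqrt n |s|
    and |s|. The absolute value appears because \<open>mult\<close> yields nonnegative roots only;
    evenness removes it afterwards.\<close>
  have pow: "?\<phi> (sqrt (real n) * \<bar>s\<bar>) = ?\<phi> s ^ n" for s n
  proof (induction n)
    case (Suc n)
    have "sqrt (real (Suc n)) * \<bar>s\<bar> = sqrt ((sqrt (real n) * \<bar>s\<bar>)\<^sup>2 + s\<^sup>2)"
      by (rule real_sqrt_unique[symmetric]) (simp_all add: power_mult_distrib algebra_simps)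
    then show ?case
      using mult[of "sqrt (real n) * \<bar>s\<bar>" s] Suc by (simp del: of_nat_Suc)
  qed (simp add: X.char_zero)
  show "?\<phi> t = ?\<phi> (t / sqrt (real n)) ^ n" if "n > 0"
  proof -
    have "?\<phi> \<bar>t\<bar> = ?\<phi> t"
      using even by (simp add: abs_if)
    then show ?thesis
      using pow[of n "t / sqrt (real n)"] that by (simp add: abs_divide)
  qed
qed

text \<open>At the argument 1 / c the characteristic function of c U + W is the mean of iexp (U + W
  / c), in which W fades as c grows. Evaluation at 1 is enough for the intended use, where U and V
  are linear combinations with free coefficients.\<close>

lemma (in prob_space) char_eq_if_perturbed_eq:
  fixes U V W :: "'a \<Rightarrow> real"
  assumes [measurable]: "U \<in> borel_measurable M" "V \<in> borel_measurable M" "W \<in> borel_measurable M"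
    and eq: "\<And>c. distr M borel (\<lambda>\<omega>. c * U \<omega> + W \<omega>) = distr M borel (\<lambda>\<omega>. c * V \<omega> + W \<omega>)"
  shows "char (distr M borel U) 1 = char (distr M borel V) 1"
proof (rule LIMSEQ_unique)
  let ?t = "\<lambda>n. 1 / real (Suc n)"
  have lim: "(\<lambda>n. char (distr M borel (\<lambda>\<omega>. real (Suc n) * F \<omega> + W \<omega>)) (?t n))
      \<longlonglongrightarrow> char (distr M borel F) 1"
    if [measurable]: "F \<in> borel_measurable M" for F
  proof -
    \<comment> \<open>The integrands have modulus 1, so the constant 1 dominates. The limit is
      written with \<open>0 * W \<omega>\<close> to match the shape of the sequence.\<close>
    have "(\<lambda>n. CLINT \<omega>|M. iexp (F \<omega> + ?t n * W \<omega>)) \<longlonglongrightarrow> (CLINT \<omega>|M. iexp (F \<omega> + 0 * W \<omega>))"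
      by (intro integral_dominated_convergence[where w="\<lambda>_. 1"] AE_I2 tendsto_intros
            LIMSEQ_inverse_real_of_nat[unfolded inverse_eq_divide])
        auto
    moreover have "?t n * (real (Suc n) * F \<omega> + W \<omega>) = F \<omega> + ?t n * W \<omega>" for n \<omega>
      by (simp add: field_simps del: of_nat_Suc)
    ultimately show ?thesis
      by (simp add: char_distr del: of_nat_Suc of_real_add of_real_mult)
  qed
  show "(\<lambda>n. char (distr M borel (\<lambda>\<omega>. real (Suc n) * U \<omega> + W \<omega>)) (?t n))
      \<longlonglongrightarrow> char (distr M borel U) 1"
    by (rule lim) simp
  show "(\<lambda>n. char (distr M borel (\<lambda>\<omega>. real (Suc n) * U \<omega> + W \<omega>)) (?t n))
      \<longlonglongrightarrow> char (distr M borel V) 1"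
    \<comment> \<open>Rewriting with \<open>eq\<close> turns the sequence for U into the one for V,
      so a single sequence has both limits.\<close>
    unfolding eq by (rule lim) simp
qed

section \<open>Mixed second moments and covariances\<close>

lemma integrable_mult_if_square_integrable:
  fixes X Y :: "'a \<Rightarrow> real"
  assumes [measurable]: "X \<in> borel_measurable M" "Y \<in> borel_measurable M"
    and "integrable M (\<lambda>\<omega>. (X \<omega>)\<^sup>2)" "integrable M (\<lambda>\<omega>. (Y \<omega>)\<^sup>2)"
  shows "integrable M (\<lambda>\<omega>. X \<omega> * Y \<omega>)"
proof (rule Bochner_Integration.integrable_bound)
  show "integrable M (\<lambda>\<omega>. (X \<omega>)\<^sup>2 + (Y \<omega>)\<^sup>2)"
    using assms by simp
  have "\<bar>x * y\<bar> \<le> x\<^sup>2 + y\<^sup>2" for x y :: real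
    using sum_squares_bound[of "\<bar>x\<bar>" "\<bar>y\<bar>"] mult_nonneg_nonneg[of "\<bar>x\<bar>" "\<bar>y\<bar>"]
    unfolding abs_mult power2_abs by linarith
  then show "AE \<omega> in M. norm (X \<omega> * Y \<omega>) \<le> norm ((X \<omega>)\<^sup>2 + (Y \<omega>)\<^sup>2)"
    by (intro AE_I2) simp
qed simp

text \<open>The second moments of X + W and -X + W agree, and their expansions differ by four times
  the mean of X W.\<close>

lemma expectation_mult_eq_0_if_reflection_invariant:
  fixes X W :: "'a \<Rightarrow> real"
  assumes [measurable]: "X \<in> borel_measurable M" "W \<in> borel_measurable M"
    and int: "integrable M (\<lambda>\<omega>. (X \<omega>)\<^sup>2)" "integrable M (\<lambda>\<omega>. (W \<omega>)\<^sup>2)"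
    and refl: "distr M borel (\<lambda>\<omega>. X \<omega> + W \<omega>) = distr M borel (\<lambda>\<omega>. - X \<omega> + W \<omega>)"
  shows "integral\<^sup>L M (\<lambda>\<omega>. X \<omega> * W \<omega>) = 0"
proof -
  have [simp]: "integrable M (\<lambda>\<omega>. X \<omega> * W \<omega>)"
    using int by (intro integrable_mult_if_square_integrable) auto
  have "integral\<^sup>L (distr M borel (\<lambda>\<omega>. X \<omega> + W \<omega>)) (\<lambda>x. x\<^sup>2) =
      integral\<^sup>L (distr M borel (\<lambda>\<omega>. - X \<omega> + W \<omega>)) (\<lambda>x. x\<^sup>2)"
    by (simp only: refl)
  then have "(\<integral>\<omega>. (X \<omega>)\<^sup>2 + (W \<omega>)\<^sup>2 + 2 * (X \<omega> * W \<omega>) \<partial>M) =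
      (\<integral>\<omega>. (X \<omega>)\<^sup>2 + (W \<omega>)\<^sup>2 - 2 * (X \<omega> * W \<omega>) \<partial>M)"
    by (simp add: integral_distr power2_eq_square algebra_simps)
  then show ?thesis
    using int by simp
qed

lemma integrable_power_if_finite_moments:
  fixes X :: "'a \<Rightarrow> real"
  assumes [measurable]: "X \<in> borel_measurable M" and "finite_moments M X"
  shows "integrable M (\<lambda>\<omega>. X \<omega> ^ n)"
proof (rule Bochner_Integration.integrable_bound)
  show "integrable M (\<lambda>\<omega>. \<bar>X \<omega>\<bar> ^ n)"
    using assms by (simp add: finite_moments_def)
qed (auto simp: power_abs)

lemma (in prob_space) second_moment_pos:
  fixes X :: "'a \<Rightarrow> real"
  assumes "integrable M (\<lambda>\<omega>. (X \<omega>)\<^sup>2)" "nondegenerate M X"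
  shows "expectation (\<lambda>\<omega>. (X \<omega>)\<^sup>2) > 0"
proof -
  have "expectation (\<lambda>\<omega>. (X \<omega>)\<^sup>2) \<noteq> 0"
    using assms integral_nonneg_eq_0_iff_AE[OF assms(1)] by (auto simp: nondegenerate_def)
  moreover have "expectation (\<lambda>\<omega>. (X \<omega>)\<^sup>2) \<ge> 0"
    by simp
  ultimately show ?thesis
    by linarith
qed

text \<open>Reflection invariance controls only the product of X with the whole remainder Y + Z;
  \<open>XZ\<close> removes the share of Z, and since X is centred what is left is the covariance
  with Y. In the application Z belongs to the other, independent vector.\<close>

lemma (in prob_space) covariance_eq_0_if_reflection_invariant:
  fixes X Y Z :: "'a \<Rightarrow> real"
  assumes [measurable]: "X \<in> borel_measurable M" "Y \<in> borel_measurable M" "Z \<in> borel_measurable M"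
    and int: "integrable M (\<lambda>\<omega>. (X \<omega>)\<^sup>2)" "integrable M (\<lambda>\<omega>. (Y \<omega>)\<^sup>2)"
      "integrable M (\<lambda>\<omega>. (Z \<omega>)\<^sup>2)"
    and mean: "expectation X = 0" and XZ: "expectation (\<lambda>\<omega>. X \<omega> * Z \<omega>) = 0"
    and refl: "distr M borel (\<lambda>\<omega>. X \<omega> + (Y \<omega> + Z \<omega>)) = distr M borel (\<lambda>\<omega>. - X \<omega> + (Y \<omega> + Z \<omega>))"
  shows "covariance M X Y = 0"
proof -
  have [simp]: "integrable M X"
    using assms(1) int(1) by (rule square_integrable_imp_integrable)
  have [simp]: "integrable M (\<lambda>\<omega>. X \<omega> * Y \<omega>)" "integrable M (\<lambda>\<omega>. X \<omega> * Z \<omega>)"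
    "integrable M (\<lambda>\<omega>. Y \<omega> * Z \<omega>)"
    using int by (auto intro!: integrable_mult_if_square_integrable)
  have "integrable M (\<lambda>\<omega>. (Y \<omega> + Z \<omega>)\<^sup>2)"
    using int by (simp add: power2_sum mult.assoc)
  with int(1) refl have "expectation (\<lambda>\<omega>. X \<omega> * (Y \<omega> + Z \<omega>)) = 0"
    by (intro expectation_mult_eq_0_if_reflection_invariant) auto
  then have "expectation (\<lambda>\<omega>. X \<omega> * Y \<omega>) = 0"
    using XZ by (simp add: distrib_left)
  then show ?thesis
    by (simp add: covariance_def mean right_diff_distrib)
qed

theorem proposition3p1:
  fixes M :: "'a measure" and S1 Y S2 Z :: "'a \<Rightarrow> real"
  assumes "prob_space M"
    and "S1 \<in> borel_measurable M" "Y \<in> borel_measurable M"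
        "S2 \<in> borel_measurable M" "Z \<in> borel_measurable M"
    and "finite_moments M S1" "finite_moments M Y"
        "finite_moments M S2" "finite_moments M Z"
    and "prob_space.indep_var M
           (borel \<Otimes>\<^sub>M borel) (\<lambda>\<omega>. (S1 \<omega>, Y \<omega>))
           (borel \<Otimes>\<^sub>M borel) (\<lambda>\<omega>. (S2 \<omega>, Z \<omega>))"
    and "nondegenerate M S1" "nondegenerate M S2"
    and "\<And>a b a' b' :: real. a\<^sup>2 + b\<^sup>2 = a'\<^sup>2 + b'\<^sup>2 \<Longrightarrow>
           distr M borel (\<lambda>\<omega>. a * S1 \<omega> + Y \<omega> + b * S2 \<omega> + Z \<omega>) =
           distr M borel (\<lambda>\<omega>. a' * S1 \<omega> + Y \<omega> + b' * S2 \<omega> + Z \<omega>)"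
  shows "(\<exists>\<mu> \<sigma>. \<sigma> > 0 \<and>
            distributed M lborel S1 (normal_density \<mu> \<sigma>) \<and>
            distributed M lborel S2 (normal_density \<mu> \<sigma>)) \<and>
         covariance M S1 Y = 0 \<and> covariance M S2 Z = 0"
proof -
  interpret prob_space M by fact
  note rv [measurable] = assms(2-5)
  note moments = assms(6-9) and ind = assms(10) and nondeg = assms(11,12) and law = assms(13)
  have sq: "integrable M (\<lambda>\<omega>. (S1 \<omega>)\<^sup>2)" "integrable M (\<lambda>\<omega>. (Y \<omega>)\<^sup>2)"
    "integrable M (\<lambda>\<omega>. (S2 \<omega>)\<^sup>2)" "integrable M (\<lambda>\<omega>. (Z \<omega>)\<^sup>2)"
    using rv moments by (auto intro: integrable_power_if_finite_moments)
  have int [simp]: "integrable M S1" "integrable M Y" "integrable M S2" "integrable M Z"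
    using rv sq by (auto intro: square_integrable_imp_integrable)
  have cube: "integrable M (\<lambda>\<omega>. \<bar>S1 \<omega>\<bar> ^ 3)"
    using moments(1) by (simp add: finite_moments_def)

  let ?\<phi> = "char (distr M borel S1)" and ?\<psi> = "char (distr M borel S2)"
  \<comment> \<open>This is the joint characteristic function of (S1, S2) at (a, b), with the point
    absorbed into the random variable. Independence of the vectors passes to their first
    components.\<close>
  have lin: "char (distr M borel (\<lambda>\<omega>. a * S1 \<omega> + b * S2 \<omega>)) 1 = ?\<phi> a * ?\<psi> b" for a b
  proof -
    have "indep_var borel ((\<lambda>x. a * fst x) \<circ> (\<lambda>\<omega>. (S1 \<omega>, Y \<omega>)))
        borel ((\<lambda>x. b * fst x) \<circ> (\<lambda>\<omega>. (S2 \<omega>, Z \<omega>)))"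
      by (rule indep_var_compose[OF ind]) measurable
    then have "indep_var borel (\<lambda>\<omega>. a * S1 \<omega>) borel (\<lambda>\<omega>. b * S2 \<omega>)"
      by (simp add: comp_def)
    from char_distr_add[OF this, of 1] show ?thesis
      by (simp add: char_distr_cmult)
  qed
  have rot: "?\<phi> a * ?\<psi> b = ?\<phi> a' * ?\<psi> b'" if "a\<^sup>2 + b\<^sup>2 = a'\<^sup>2 + b'\<^sup>2" for a b a' b'
    unfolding lin[symmetric]
  proof (rule char_eq_if_perturbed_eq[where W="\<lambda>\<omega>. Y \<omega> + Z \<omega>"])
    fix c
    \<comment> \<open>Scaling both points by the same c keeps them on a common circle, so the
      hypothesis on the laws applies for every c, as the perturbation argument requires.\<close>
    have "(c * a)\<^sup>2 + (c * b)\<^sup>2 = (c * a')\<^sup>2 + (c * b')\<^sup>2"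
      using that by (simp add: power_mult_distrib flip: distrib_left)
    from law[OF this]
    show "distr M borel (\<lambda>\<omega>. c * (a * S1 \<omega> + b * S2 \<omega>) + (Y \<omega> + Z \<omega>)) =
        distr M borel (\<lambda>\<omega>. c * (a' * S1 \<omega> + b' * S2 \<omega>) + (Y \<omega> + Z \<omega>))"
      by (simp add: algebra_simps)
  qed measurable
  note chars = rotation_invariant_chars[OF rv(1,3) rot]

  have mean1: "expectation S1 = 0"
    using chars(2) by (intro expectation_eq_0_if_symmetric) auto
  have mean2: "expectation S2 = 0"
    using chars(1,2) by (intro expectation_eq_0_if_symmetric) auto

  \<comment> \<open>The mean is 0, so this is the standard deviation of S1, positive by
    nondegeneracy. It serves for S2 as well because the two characteristic functions
    coincide.\<close>
  define \<sigma> where "\<sigma> = sqrt (expectation (\<lambda>\<omega>. (S1 \<omega>)\<^sup>2))"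
  have \<sigma>: "\<sigma> > 0"
    using second_moment_pos[OF sq(1) nondeg(1)] by (simp add: \<sigma>_def)
  have "expectation (\<lambda>\<omega>. (S1 \<omega>)\<^sup>2) = \<sigma>\<^sup>2"
    by (simp add: \<sigma>_def)
  then have \<phi>: "?\<phi> t = complex_of_real (exp (- (\<sigma>\<^sup>2 * t\<^sup>2 / 2)))" for t
    by (intro char_eq_exp_if_stable rv int sq cube mean1 chars(3))
  have normal: "distributed M lborel S1 (normal_density 0 \<sigma>)"
    "distributed M lborel S2 (normal_density 0 \<sigma>)"
    using \<phi> chars(1) \<sigma> by (auto intro!: distributed_normal_density_if_char)

  \<comment> \<open>S1 and Z come from different vectors, so the mean of their product factors and
    vanishes with the mean of S1.\<close>
  have "indep_var borel (fst \<circ> (\<lambda>\<omega>. (S1 \<omega>, Y \<omega>))) borel (snd \<circ> (\<lambda>\<omega>. (S2 \<omega>, Z \<omega>)))"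
    by (rule indep_var_compose[OF ind]) measurable
  then have "expectation (\<lambda>\<omega>. S1 \<omega> * Z \<omega>) = 0"
    using indep_var_lebesgue_integral[of S1 Z] by (simp add: comp_def mean1)
  \<comment> \<open>The points (1, 0) and (-1, 0) lie on one circle; the coefficient b = 0 removes
    S2.\<close>
  moreover have "distr M borel (\<lambda>\<omega>. S1 \<omega> + (Y \<omega> + Z \<omega>)) = distr M borel (\<lambda>\<omega>. - S1 \<omega> + (Y \<omega> + Z \<omega>))"
    using law[of 1 0 "-1" 0] by (simp add: algebra_simps)
  ultimately have cov1: "covariance M S1 Y = 0"
    using sq mean1 by (intro covariance_eq_0_if_reflection_invariant[where Z=Z]) auto

  \<comment> \<open>The same argument with the two vectors exchanged, now using the points (0, 1)
    and (0, -1).\<close>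
  have "indep_var borel (snd \<circ> (\<lambda>\<omega>. (S1 \<omega>, Y \<omega>))) borel (fst \<circ> (\<lambda>\<omega>. (S2 \<omega>, Z \<omega>)))"
    by (rule indep_var_compose[OF ind]) measurable
  then have "expectation (\<lambda>\<omega>. S2 \<omega> * Y \<omega>) = 0"
    using indep_var_lebesgue_integral[of Y S2] by (simp add: comp_def mean2 mult.commute)
  moreover have "distr M borel (\<lambda>\<omega>. S2 \<omega> + (Z \<omega> + Y \<omega>)) = distr M borel (\<lambda>\<omega>. - S2 \<omega> + (Z \<omega> + Y \<omega>))"
    using law[of 0 1 0 "-1"] by (simp add: algebra_simps)
  ultimately have cov2: "covariance M S2 Z = 0"
    using sq mean2 by (intro covariance_eq_0_if_reflection_invariant[where Z=Y]) auto

  show ?thesis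
    using \<sigma> normal cov1 cov2 by blast
qed

end
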